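(* The assignment $$X\mapsto(\mathcal P(X),\prec),\qquad [\eta]\mapsto[\eta^{\mathcal P}],\quad \eta^{\mathcal P}:\mathcal P(X)\to\mathcal P(Y),\ S\mapsto\eta(S)\quad(\eta\in\mathrm{CtrTotRel}(X,Y)),$$ defines a functor $\mathbf{Coarse}_{\mathrm{CtrTotRel}}/\mathrm{close}\to\mathbf{FJ}\text{-}\mathbf{hPreOrd}$. Moreover, the assignment $$X\mapsto(\mathcal P_c(X),\prec),\qquad [\eta]\mapsto[\eta]^{\mathcal P_c},$$ where $$[\eta]^{\mathcal P_c}:\mathcal P_c(X)\to\mathcal P_c(Y),\qquad [S]\mapsto[\eta(S)],$$ is the map induced by $\eta^{\mathcal P}$ on anti-symmetrizations, defines a functor $$\mathcal P_c:\mathbf{Coarse}_{\mathrm{CtrTotRel}}/\mathrm{close}\to\mathbf{FJ}\text{-}\mathbf{Par}_{\mathrm{open}}.$$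
   Context: Throughout, "set" (underlying a coarse space) means an element of a fixed universe $\mathcal U$ with $\mathbb N\in\mathcal U$; pre-ordered sets are elements of a fixed universe $\mathcal V$ with $\mathcal U\in\mathcal V$. Relations. For sets $X,Y$, a relation from $X$ to $Y$ is a subset $R\subset Y\times X$; $\mathrm{Rel}(X,Y)=\mathcal P(Y\times X)$, $\mathrm{Rel}(X)=\mathrm{Rel}(X,X)$. $S\circ R=\{(z,x)\mid \exists y,\ (z,y)\in S,\ (y,x)\in R\}$; $1_X^{\mathrm{Rel}}=\{(x,x)\mid x\in X\}$; $R^\dagger=\{(x,y)\mid (y,x)\in R\}$; $\mathrm{Ad}_R(E)=R\circ E\circ R^\dagger$ for $E\in\mathrm{Rel}(X)$; $R(S)=\{y\in Y\mid \exists s\in S,\ (y,s)\in R\}$ for $S\subset X$. $R$ is total if for every $x\in X$ there is $y\in Y$ with $(y,x)\in R$. Coarse spaces. A coarse structure on $X$ is a subset $\mathcal E\subset\mathrm{Rel}(X)$ containing $1_X^{\mathrm{Rel}}$ and closed under composition, dagger, finite unions and passing to subsets; a coarse space is a pair $X=(X,\mathcal E_X)$. A relation $\eta\in\mathrm{Rel}(X,Y)$ between coarse spaces is controlled if $\mathrm{Ad}_\eta(E)\in\mathcal E_Y$ for all $E\in\mathcal E_X$; $\mathrm{CtrTotRel}(X,Y)$ is the set of controlled total relations. For relations, $\eta_1\prec\eta_2$ means $\eta_1\subset F\circ\eta_2\circ E$ for some $E\in\mathcal E_X,F\in\mathcal E_Y$; $\eta_1\sim\eta_2$ ("close") means $\eta_1\prec\eta_2$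 and $\eta_2\prec\eta_1$. $\mathbf{Coarse}_{\mathrm{CtrTotRel}}/\mathrm{close}$ is the category whose objects are coarse spaces and whose morphisms $X\to Y$ are the $\sim$-classes $[\eta]$ of $\eta\in\mathrm{CtrTotRel}(X,Y)$, with composition $[\xi]\circ[\eta]=[\xi\circ\eta]$ and identities $[1_X^{\mathrm{Rel}}]$ (closeness is a congruence). Coarse subspaces. For a coarse space $X$ and $A,B\subset X$, $A\prec B$ means there is $E\in\mathcal E_X$ with $A\subset E(B)$; this is a pre-order on $\mathcal P(X)$. $\mathcal P_c(X)$ is its anti-symmetrization, i.e. the quotient of $\mathcal P(X)$ by $A\sim B\iff(A\prec B$ and $B\prec A)$, with the induced partial order. Order categories. In a pre-ordered set $(P,\prec)$, $\bigvee S$ denotes the set of least upper bounds of $S\subset P$; $P$ is finite join if $\bigvee S\neq\emptyset$ for every finite $S\subset P$ (including $S=\emptyset$). An order-preserving $f:P\to Q$ between finite-join pre-ordered sets preserves finite joins if $f(\bigvee S)\subset\bigvee f(S)$ for all finite $S$. Two order-preserving maps $f,g:P\to Q$ are equivalent, $f\sim g$, if $f(x)\prec g(x)$ and $g(x)\prec f(x)$ for all $x$. $\mathbf{FJ}\text{-}\mathbf{hPreOrd}$ has finite-join pre-ordered sets as objects and $\sim$-classes $[f]$ of finite-join-preserving order-preserving maps as morphisms. A subset $L\subset P$ is lower if $a\prec x\in L$ implies $a\in L$; an order-preserving map is open if it sends lower subsets to lower subsets. $\mathbf{FJ}\text{-}\mathbf{Par}_{\mathrm{open}}$ has finite-join partially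 ordered sets as objects and open, finite-join-preserving, order-preserving maps as morphisms. *)

theory Defs
  imports Main "HOL-Library.FuncSet"
begin

section \<open>Categories and functors\<close>

text \<open>
  Hom-sets are indexed by source and target and need not be disjoint.  Accordingly composition
  and the arrow part of a functor take the objects involved as arguments:
  \<open>Comp C X Y Z g f\<close> is \<open>g \<circ> f\<close> for \<open>f : X \<rightarrow> Y\<close> and \<open>g : Y \<rightarrow> Z\<close>.
\<close>

record ('o, 'm) precategory =
  Obj :: "'o set"
  Hom :: "'o \<Rightarrow> 'o \<Rightarrow> 'm set"
  Ident :: "'o \<Rightarrow> 'm"
  Comp :: "'o \<Rightarrow> 'o \<Rightarrow> 'o \<Rightarrow> 'm \<Rightarrow> 'm \<Rightarrow> 'm"

definition is_category :: "('o, 'm) precategory \<Rightarrow> bool" where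
  "is_category C \<longleftrightarrow>
     (\<forall>X\<in>Obj C. Ident C X \<in> Hom C X X) \<and>
     (\<forall>X\<in>Obj C. \<forall>Y\<in>Obj C. \<forall>Z\<in>Obj C. \<forall>f\<in>Hom C X Y. \<forall>g\<in>Hom C Y Z.
        Comp C X Y Z g f \<in> Hom C X Z) \<and>
     (\<forall>X\<in>Obj C. \<forall>Y\<in>Obj C. \<forall>f\<in>Hom C X Y.
        Comp C X X Y f (Ident C X) = f \<and> Comp C X Y Y (Ident C Y) f = f) \<and>
     (\<forall>W\<in>Obj C. \<forall>X\<in>Obj C. \<forall>Y\<in>Obj C. \<forall>Z\<in>Obj C.
        \<forall>f\<in>Hom C W X. \<forall>g\<in>Hom C X Y. \<forall>h\<in>Hom C Y Z.
          Comp C W X Z (Comp C X Y Z h g) f = Comp C W Y Z h (Comp C W X Y g f))"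

definition is_functor ::
  "('o, 'm) precategory \<Rightarrow> ('p, 'n) precategory \<Rightarrow> ('o \<Rightarrow> 'p) \<Rightarrow> ('o \<Rightarrow> 'o \<Rightarrow> 'm \<Rightarrow> 'n) \<Rightarrow> bool" where
  "is_functor C D F_obj F_arr \<longleftrightarrow>
     is_category C \<and> is_category D \<and>
     (\<forall>X\<in>Obj C. F_obj X \<in> Obj D) \<and>
     (\<forall>X\<in>Obj C. \<forall>Y\<in>Obj C. \<forall>f\<in>Hom C X Y. F_arr X Y f \<in> Hom D (F_obj X) (F_obj Y)) \<and>
     (\<forall>X\<in>Obj C. F_arr X X (Ident C X) = Ident D (F_obj X)) \<and>
     (\<forall>X\<in>Obj C. \<forall>Y\<in>Obj C. \<forall>Z\<in>Obj C. \<forall>f\<in>Hom C X Y. \<forall>g\<in>Hom C Y Z.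
        F_arr X Z (Comp C X Y Z g f)
          = Comp D (F_obj X) (F_obj Y) (F_obj Z) (F_arr Y Z g) (F_arr X Y f))"


section \<open>Coarse spaces\<close>

text \<open>
  A relation from \<open>X\<close> to \<open>Y\<close> is a subset of \<open>Y \<times> X\<close> (target first).  With this convention
  the composite of \<open>R\<close> followed by \<open>S\<close> is \<^term>\<open>S O R\<close>, the dagger of \<open>R\<close> is \<^term>\<open>converse R\<close>,
  and the identity relation is \<^const>\<open>Id_on\<close>.
\<close>

definition rel_app :: "('b \<times> 'a) set \<Rightarrow> 'a set \<Rightarrow> 'b set" where
  "rel_app R S = {y. \<exists>s\<in>S. (y, s) \<in> R}"

definition Ad :: "('b \<times> 'a) set \<Rightarrow> ('a \<times> 'a) set \<Rightarrow> ('b \<times> 'b) set" where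
  "Ad R E = R O E O converse R"

record 'a coarse =
  points :: "'a set"
  entourages :: "('a \<times> 'a) set set"

definition coarse_space :: "'a coarse \<Rightarrow> bool" where
  "coarse_space X \<longleftrightarrow>
     entourages X \<subseteq> Pow (points X \<times> points X) \<and>
     Id_on (points X) \<in> entourages X \<and>
     (\<forall>E\<in>entourages X. \<forall>F\<in>entourages X. E O F \<in> entourages X) \<and>
     (\<forall>E\<in>entourages X. converse E \<in> entourages X) \<and>
     (\<forall>\<A>\<subseteq>entourages X. finite \<A> \<longrightarrow> \<Union>\<A> \<in> entourages X) \<and>
     (\<forall>E\<in>entourages X. \<forall>F\<subseteq>E. F \<in> entourages X)"

definition controlled :: "'a coarse \<Rightarrow> 'b coarse \<Rightarrow> ('b \<times> 'a) set \<Rightarrow> bool" where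
  "controlled X Y \<eta> \<longleftrightarrow> (\<forall>E\<in>entourages X. Ad \<eta> E \<in> entourages Y)"

definition total_rel :: "'a coarse \<Rightarrow> 'b coarse \<Rightarrow> ('b \<times> 'a) set \<Rightarrow> bool" where
  "total_rel X Y \<eta> \<longleftrightarrow> (\<forall>x\<in>points X. \<exists>y\<in>points Y. (y, x) \<in> \<eta>)"

definition CtrTotRel :: "'a coarse \<Rightarrow> 'b coarse \<Rightarrow> ('b \<times> 'a) set set" where
  "CtrTotRel X Y = {\<eta>. \<eta> \<subseteq> points Y \<times> points X \<and> controlled X Y \<eta> \<and> total_rel X Y \<eta>}"

definition rel_prec :: "'a coarse \<Rightarrow> 'b coarse \<Rightarrow> ('b \<times> 'a) set \<Rightarrow> ('b \<times> 'a) set \<Rightarrow> bool" where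
  "rel_prec X Y \<eta>\<^sub>1 \<eta>\<^sub>2 \<longleftrightarrow> (\<exists>E\<in>entourages X. \<exists>F\<in>entourages Y. \<eta>\<^sub>1 \<subseteq> F O \<eta>\<^sub>2 O E)"

definition close_eq :: "'a coarse \<Rightarrow> 'b coarse \<Rightarrow> ('b \<times> 'a) set rel" where
  "close_eq X Y =
     {(\<eta>\<^sub>1, \<eta>\<^sub>2) \<in> CtrTotRel X Y \<times> CtrTotRel X Y. rel_prec X Y \<eta>\<^sub>1 \<eta>\<^sub>2 \<and> rel_prec X Y \<eta>\<^sub>2 \<eta>\<^sub>1}"

definition close_class :: "'a coarse \<Rightarrow> 'b coarse \<Rightarrow> ('b \<times> 'a) set \<Rightarrow> ('b \<times> 'a) set set" where
  "close_class X Y \<eta> = close_eq X Y `` {\<eta>}"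

text \<open>
  Operations on classes are lifted by taking the union of the result classes over all
  representatives; this is a single class exactly when the operation respects the equivalence.
\<close>

definition Coarse_close :: "('a coarse, ('a \<times> 'a) set set) precategory" where
  "Coarse_close =
     \<lparr> Obj = {X. coarse_space X},
       Hom = (\<lambda>X Y. CtrTotRel X Y // close_eq X Y),
       Ident = (\<lambda>X. close_class X X (Id_on (points X))),
       Comp = (\<lambda>X Y Z d c. \<Union>\<xi>\<in>d. \<Union>\<eta>\<in>c. close_class X Z (\<xi> O \<eta>)) \<rparr>"


section \<open>Order categories\<close>

text \<open>\<open>(x, y) \<in> le P\<close> stands for \<open>x \<prec> y\<close>.\<close>

record 'p preord =
  elts :: "'p set"
  le :: "'p rel"

definition Lub :: "'p preord \<Rightarrow> 'p set \<Rightarrow> 'p set" where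
  "Lub P S = {u \<in> elts P. (\<forall>s\<in>S. (s, u) \<in> le P) \<and>
                          (\<forall>v\<in>elts P. (\<forall>s\<in>S. (s, v) \<in> le P) \<longrightarrow> (u, v) \<in> le P)}"

definition finite_join :: "'p preord \<Rightarrow> bool" where
  "finite_join P \<longleftrightarrow> (\<forall>S\<subseteq>elts P. finite S \<longrightarrow> Lub P S \<noteq> {})"

definition order_preserving :: "'p preord \<Rightarrow> 'q preord \<Rightarrow> ('p \<Rightarrow> 'q) \<Rightarrow> bool" where
  "order_preserving P Q f \<longleftrightarrow> (\<forall>x y. (x, y) \<in> le P \<longrightarrow> (f x, f y) \<in> le Q)"

definition preserves_finite_joins :: "'p preord \<Rightarrow> 'q preord \<Rightarrow> ('p \<Rightarrow> 'q) \<Rightarrow> bool" where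
  "preserves_finite_joins P Q f \<longleftrightarrow>
     (\<forall>S\<subseteq>elts P. finite S \<longrightarrow> f ` Lub P S \<subseteq> Lub Q (f ` S))"

definition lower :: "'p preord \<Rightarrow> 'p set \<Rightarrow> bool" where
  "lower P L \<longleftrightarrow> L \<subseteq> elts P \<and> (\<forall>x\<in>L. \<forall>a\<in>elts P. (a, x) \<in> le P \<longrightarrow> a \<in> L)"

definition open_map :: "'p preord \<Rightarrow> 'q preord \<Rightarrow> ('p \<Rightarrow> 'q) \<Rightarrow> bool" where
  "open_map P Q f \<longleftrightarrow> (\<forall>L. lower P L \<longrightarrow> lower Q (f ` L))"

text \<open>
  Maps are extensional (\<^const>\<open>undefined\<close> outside the domain), so that equality of maps
  is equality on the domain.
\<close>

definition FJ_maps :: "'p preord \<Rightarrow> 'q preord \<Rightarrow> ('p \<Rightarrow> 'q) set" where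
  "FJ_maps P Q =
     {f \<in> elts P \<rightarrow>\<^sub>E elts Q. order_preserving P Q f \<and> preserves_finite_joins P Q f}"

definition map_eq :: "'p preord \<Rightarrow> 'q preord \<Rightarrow> ('p \<Rightarrow> 'q) rel" where
  "map_eq P Q =
     {(f, g) \<in> FJ_maps P Q \<times> FJ_maps P Q. \<forall>x\<in>elts P. (f x, g x) \<in> le Q \<and> (g x, f x) \<in> le Q}"

definition map_class :: "'p preord \<Rightarrow> 'q preord \<Rightarrow> ('p \<Rightarrow> 'q) \<Rightarrow> ('p \<Rightarrow> 'q) set" where
  "map_class P Q f = map_eq P Q `` {f}"

definition FJ_hPreOrd :: "('p preord, ('p \<Rightarrow> 'p) set) precategory" where
  "FJ_hPreOrd =
     \<lparr> Obj = {P. preorder_on (elts P) (le P) \<and> finite_join P},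
       Hom = (\<lambda>P Q. FJ_maps P Q // map_eq P Q),
       Ident = (\<lambda>P. map_class P P (\<lambda>x\<in>elts P. x)),
       Comp = (\<lambda>P Q R d c. \<Union>g\<in>d. \<Union>f\<in>c. map_class P R (compose (elts P) g f)) \<rparr>"

definition FJ_Par_open :: "('p preord, 'p \<Rightarrow> 'p) precategory" where
  "FJ_Par_open =
     \<lparr> Obj = {P. partial_order_on (elts P) (le P) \<and> finite_join P},
       Hom = (\<lambda>P Q. {f \<in> FJ_maps P Q. open_map P Q f}),
       Ident = (\<lambda>P. \<lambda>x\<in>elts P. x),
       Comp = (\<lambda>P Q R g f. compose (elts P) g f) \<rparr>"

definition sym_eq :: "'p preord \<Rightarrow> 'p rel" where
  "sym_eq P = {(x, y) \<in> elts P \<times> elts P. (x, y) \<in> le P \<and> (y, x) \<in> le P}"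

definition sym_class :: "'p preord \<Rightarrow> 'p \<Rightarrow> 'p set" where
  "sym_class P x = sym_eq P `` {x}"

definition antisymmetrization :: "'p preord \<Rightarrow> 'p set preord" where
  "antisymmetrization P =
     \<lparr> elts = elts P // sym_eq P,
       le = {(sym_class P x, sym_class P y) | x y. x \<in> elts P \<and> y \<in> elts P \<and> (x, y) \<in> le P} \<rparr>"


section \<open>The two assignments\<close>

definition P_obj :: "'a coarse \<Rightarrow> 'a set preord" where
  "P_obj X =
     \<lparr> elts = Pow (points X),
       le = {(A, B) \<in> Pow (points X) \<times> Pow (points X). \<exists>E\<in>entourages X. A \<subseteq> rel_app E B} \<rparr>"

definition P_map :: "'a coarse \<Rightarrow> ('b \<times> 'a) set \<Rightarrow> 'a set \<Rightarrow> 'b set" where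
  "P_map X \<eta> = (\<lambda>S\<in>Pow (points X). rel_app \<eta> S)"

definition P_arr :: "'a coarse \<Rightarrow> 'b coarse \<Rightarrow> ('b \<times> 'a) set set \<Rightarrow> ('a set \<Rightarrow> 'b set) set" where
  "P_arr X Y c = (\<Union>\<eta>\<in>c. map_class (P_obj X) (P_obj Y) (P_map X \<eta>))"

definition Pc_obj :: "'a coarse \<Rightarrow> 'a set set preord" where
  "Pc_obj X = antisymmetrization (P_obj X)"

definition Pc_arr :: "'a coarse \<Rightarrow> 'b coarse \<Rightarrow> ('b \<times> 'a) set set \<Rightarrow> 'a set set \<Rightarrow> 'b set set" where
  "Pc_arr X Y c =
     (\<lambda>\<A>\<in>elts (Pc_obj X). \<Union>\<eta>\<in>c. \<Union>S\<in>\<A>. sym_class (P_obj Y) (P_map X \<eta> S))"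

end

theory Submission
  imports Defs
begin

text \<open>
  Two facts about a controlled total relation \<open>\<eta>\<close> from \<open>X\<close> to \<open>Y\<close> carry the theorem.

  The first is the inclusion \<open>\<eta> \<circ> E \<subseteq> Ad\<^sub>\<eta>(E) \<circ> \<eta>\<close> (\<open>total_rel_slide\<close>): by totality an
  entourage of \<open>X\<close> can be moved past \<open>\<eta>\<close>, and by control it becomes an entourage of \<open>Y\<close>.
  Hence closeness is a congruence for composition, \<open>S \<mapsto> \<eta>(S)\<close> is monotone for \<open>\<prec>\<close>, and close
  relations induce equivalent maps.  Since a finite union of entourages is an entourage, the least
  upper bounds of a finite family of subsets are the subsets equivalent to its union
  (\<open>Lub_P_obj_iff\<close>).  Taking images commutes with unions, so \<open>\<eta>\<close> preserves finite joins.

  The second is that \<open>\<eta> \<circ> \<eta>\<^sup>\<dagger> = Ad\<^sub>\<eta>(1)\<close> is an entourage, so that the image of a point is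
  uniformly bounded.  If \<open>B \<subseteq> E(\<eta>(S))\<close>, the points of \<open>S\<close> with an image that \<open>E\<close> relates to a point
  of \<open>B\<close> form a set \<open>A \<subseteq> S\<close> with \<open>\<eta>(A) \<sim> B\<close> (\<open>rel_app_lift_below\<close>).  Everything below the class of
  \<open>\<eta>(S)\<close> is thus the image of something below the class of \<open>S\<close>, which is openness.

  The rest is formal.  Both the category of coarse spaces up to closeness and that of
  pre-ordered sets up to equivalence are quotients of a category by a congruence, and
  functors on the quotient are functors on the original category that identify congruent
  arrows (\<open>is_functor_from_quotient_cat\<close>).  Anti-symmetrization commutes with least upper bounds
  (\<open>Lub_antisymmetrization\<close>) and so carries finite-join-preserving maps to such maps.
\<close>

section \<open>Quotient categories\<close>

definition quotient_cat ::
  "('o, 'm) precategory \<Rightarrow> ('o \<Rightarrow> 'o \<Rightarrow> 'm rel) \<Rightarrow> ('o, 'm set) precategory" where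
  "quotient_cat C R =
     \<lparr> Obj = Obj C,
       Hom = (\<lambda>X Y. Hom C X Y // R X Y),
       Ident = (\<lambda>X. R X X `` {Ident C X}),
       Comp = (\<lambda>X Y Z d c. \<Union>g\<in>d. \<Union>f\<in>c. R X Z `` {Comp C X Y Z g f}) \<rparr>"

definition congruence_on :: "('o, 'm) precategory \<Rightarrow> ('o \<Rightarrow> 'o \<Rightarrow> 'm rel) \<Rightarrow> bool" where
  "congruence_on C R \<longleftrightarrow>
     (\<forall>X\<in>Obj C. \<forall>Y\<in>Obj C. equiv (Hom C X Y) (R X Y)) \<and>
     (\<forall>X\<in>Obj C. \<forall>Y\<in>Obj C. \<forall>Z\<in>Obj C. \<forall>(f, f')\<in>R X Y. \<forall>(g, g')\<in>R Y Z.
        (Comp C X Y Z g f, Comp C X Y Z g' f') \<in> R X Z)"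

lemma congruence_onI:
  assumes "\<And>X Y. X \<in> Obj C \<Longrightarrow> Y \<in> Obj C \<Longrightarrow> equiv (Hom C X Y) (R X Y)"
    and "\<And>X Y Z f f' g g'. X \<in> Obj C \<Longrightarrow> Y \<in> Obj C \<Longrightarrow> Z \<in> Obj C \<Longrightarrow>
           (f, f') \<in> R X Y \<Longrightarrow> (g, g') \<in> R Y Z \<Longrightarrow> (Comp C X Y Z g f, Comp C X Y Z g' f') \<in> R X Z"
  shows "congruence_on C R"
  using assms unfolding congruence_on_def by fast

lemma congruence_on_equiv:
  "congruence_on C R \<Longrightarrow> X \<in> Obj C \<Longrightarrow> Y \<in> Obj C \<Longrightarrow> equiv (Hom C X Y) (R X Y)"
  by (simp add: congruence_on_def)

lemma congruence_on_comp:
  assumes "congruence_on C R" "X \<in> Obj C" "Y \<in> Obj C" "Z \<in> Obj C"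
    and "(f, f') \<in> R X Y" "(g, g') \<in> R Y Z"
  shows "(Comp C X Y Z g f, Comp C X Y Z g' f') \<in> R X Z"
  using assms unfolding congruence_on_def by blast

lemma Comp_quotient_cat:
  assumes R: "congruence_on C R"
    and obj: "X \<in> Obj C" "Y \<in> Obj C" "Z \<in> Obj C"
    and f: "f \<in> Hom C X Y" and g: "g \<in> Hom C Y Z"
  shows "Comp (quotient_cat C R) X Y Z (R Y Z `` {g}) (R X Y `` {f}) =
         R X Z `` {Comp C X Y Z g f}"
proof -
  have "congruent2 (R Y Z) (R X Y) (\<lambda>g f. R X Z `` {Comp C X Y Z g f})"
    using congruence_on_comp[OF R obj] congruence_on_equiv[OF R obj(1,3)]
    by (auto simp: congruent2_def intro!: equiv_class_eq)
  from UN_equiv_class2[OF congruence_on_equiv[OF R obj(2,3)]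
      congruence_on_equiv[OF R obj(1,2)] this g f]
  show ?thesis by (simp add: quotient_cat_def)
qed

lemma Hom_quotient_catE:
  assumes "c \<in> Hom (quotient_cat C R) X Y"
  obtains f where "f \<in> Hom C X Y" "c = R X Y `` {f}"
  using assms by (auto simp: quotient_cat_def elim: quotientE)

lemma Hom_quotient_catI: "f \<in> Hom C X Y \<Longrightarrow> R X Y `` {f} \<in> Hom (quotient_cat C R) X Y"
  by (simp add: quotient_cat_def quotientI)

lemma Obj_quotient_cat [simp]: "Obj (quotient_cat C R) = Obj C"
  and Ident_quotient_cat [simp]: "Ident (quotient_cat C R) X = R X X `` {Ident C X}"
  by (simp_all add: quotient_cat_def)

lemma is_categoryD:
  assumes "is_category C"
  shows "X \<in> Obj C \<Longrightarrow> Ident C X \<in> Hom C X X"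
    and "X \<in> Obj C \<Longrightarrow> Y \<in> Obj C \<Longrightarrow> Z \<in> Obj C \<Longrightarrow> f \<in> Hom C X Y \<Longrightarrow> g \<in> Hom C Y Z \<Longrightarrow>
      Comp C X Y Z g f \<in> Hom C X Z"
    and "X \<in> Obj C \<Longrightarrow> Y \<in> Obj C \<Longrightarrow> f \<in> Hom C X Y \<Longrightarrow> Comp C X X Y f (Ident C X) = f"
    and "X \<in> Obj C \<Longrightarrow> Y \<in> Obj C \<Longrightarrow> f \<in> Hom C X Y \<Longrightarrow> Comp C X Y Y (Ident C Y) f = f"
    and "W \<in> Obj C \<Longrightarrow> X \<in> Obj C \<Longrightarrow> Y \<in> Obj C \<Longrightarrow> Z \<in> Obj C \<Longrightarrow>
      f \<in> Hom C W X \<Longrightarrow> g \<in> Hom C X Y \<Longrightarrow> h \<in> Hom C Y Z \<Longrightarrow>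
      Comp C W X Z (Comp C X Y Z h g) f = Comp C W Y Z h (Comp C W X Y g f)"
  using assms by (simp_all add: is_category_def)

lemma is_category_quotient_cat:
  assumes C: "is_category C" and R: "congruence_on C R"
  shows "is_category (quotient_cat C R)"
  unfolding is_category_def Obj_quotient_cat
  by (intro conjI ballI; (elim Hom_quotient_catE)?;
      simp add: Comp_quotient_cat[OF R] Hom_quotient_catI is_categoryD[OF C])

lemma is_functor_from_quotient_cat:
  assumes F: "is_functor C D F_obj F_arr" and R: "congruence_on C R"
    and lift: "\<And>X Y f. X \<in> Obj C \<Longrightarrow> Y \<in> Obj C \<Longrightarrow> f \<in> Hom C X Y \<Longrightarrow>
                  G_arr X Y (R X Y `` {f}) = F_arr X Y f"
  shows "is_functor (quotient_cat C R) D F_obj G_arr"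
proof -
  have C: "is_category C" using F by (simp add: is_functor_def)
  note F' = F[unfolded is_functor_def]
  show ?thesis
    unfolding is_functor_def Obj_quotient_cat
    by (intro conjI ballI is_category_quotient_cat[OF C R]; (elim Hom_quotient_catE)?;
        simp add: F' lift Comp_quotient_cat[OF R] is_categoryD[OF C])
qed

lemma is_functor_into_quotient_cat:
  assumes F: "is_functor C D F_obj F_arr" and R: "congruence_on D R"
  shows "is_functor C (quotient_cat D R) F_obj (\<lambda>X Y f. R (F_obj X) (F_obj Y) `` {F_arr X Y f})"
  using F unfolding is_functor_def
  by (simp add: is_category_quotient_cat[OF _ R] Hom_quotient_catI Comp_quotient_cat[OF R])


section \<open>The category of coarse spaces\<close>

lemma coarse_spaceD:
  assumes "coarse_space X"
  shows "E \<in> entourages X \<Longrightarrow> E \<subseteq> points X \<times> points X"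
    and "Id_on (points X) \<in> entourages X"
    and "E \<in> entourages X \<Longrightarrow> F \<in> entourages X \<Longrightarrow> E O F \<in> entourages X"
    and "E \<in> entourages X \<Longrightarrow> converse E \<in> entourages X"
    and "\<A> \<subseteq> entourages X \<Longrightarrow> finite \<A> \<Longrightarrow> \<Union>\<A> \<in> entourages X"
    and "E \<in> entourages X \<Longrightarrow> F \<subseteq> E \<Longrightarrow> F \<in> entourages X"
proof -
  note X = assms[unfolded coarse_space_def]
  from X show "E \<in> entourages X \<Longrightarrow> E \<subseteq> points X \<times> points X" by (elim conjE) blast
  from X show "Id_on (points X) \<in> entourages X" by (elim conjE)
  from X show "E \<in> entourages X \<Longrightarrow> F \<in> entourages X \<Longrightarrow> E O F \<in> entourages X" by simp
  from X show "E \<in> entourages X \<Longrightarrow> converse E \<in> entourages X" by simp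
  from X show "\<A> \<subseteq> entourages X \<Longrightarrow> finite \<A> \<Longrightarrow> \<Union>\<A> \<in> entourages X" by simp
  from X show "E \<in> entourages X \<Longrightarrow> F \<subseteq> E \<Longrightarrow> F \<in> entourages X" by simp
qed

lemma CtrTotRelD:
  assumes "\<eta> \<in> CtrTotRel X Y"
  shows "\<eta> \<subseteq> points Y \<times> points X"
    and "E \<in> entourages X \<Longrightarrow> Ad \<eta> E \<in> entourages Y"
    and "total_rel X Y \<eta>"
  using assms by (auto simp: CtrTotRel_def controlled_def)

text \<open>
  Totality lets \<open>x\<close> be followed by some \<open>y\<close> with \<open>(y, x) \<in> \<eta>\<close>, and going back along \<open>\<eta>\<^sup>\<dagger>\<close> from
  that \<open>y\<close> returns to \<open>x\<close>; so \<open>E \<subseteq> E \<circ> \<eta>\<^sup>\<dagger> \<circ> \<eta>\<close>.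
\<close>
lemma total_rel_slide:
  assumes "total_rel X Y \<eta>" "E \<subseteq> points X \<times> points X"
  shows "\<eta> O E \<subseteq> Ad \<eta> E O \<eta>"
proof
  fix p assume "p \<in> \<eta> O E"
  then obtain z x' x where p: "p = (z, x)" "(z, x') \<in> \<eta>" "(x', x) \<in> E" by blast
  then obtain y where "(y, x) \<in> \<eta>" using assms unfolding total_rel_def by blast
  with p show "p \<in> Ad \<eta> E O \<eta>" unfolding Ad_def by blast
qed

lemma Ad_relcomp: "Ad (\<xi> O \<eta>) E = Ad \<xi> (Ad \<eta> E)"
  by (simp add: Ad_def converse_relcomp O_assoc)

lemma Id_on_CtrTotRel:
  assumes "coarse_space X"
  shows "Id_on (points X) \<in> CtrTotRel X X"
proof -
  have "Ad (Id_on (points X)) E \<subseteq> E" for E by (auto simp: Ad_def)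
  then have "controlled X X (Id_on (points X))"
    unfolding controlled_def using coarse_spaceD(6)[OF assms] by blast
  then show ?thesis by (auto simp: CtrTotRel_def total_rel_def)
qed

lemma relcomp_CtrTotRel:
  assumes "\<eta> \<in> CtrTotRel X Y" "\<xi> \<in> CtrTotRel Y Z"
  shows "\<xi> O \<eta> \<in> CtrTotRel X Z"
proof -
  have "total_rel X Z (\<xi> O \<eta>)"
    using CtrTotRelD(3)[OF assms(1)] CtrTotRelD(3)[OF assms(2)]
    unfolding total_rel_def by (meson relcomp.relcompI)
  moreover have "controlled X Z (\<xi> O \<eta>)"
    using assms by (simp add: controlled_def Ad_relcomp CtrTotRelD)
  moreover have "\<xi> O \<eta> \<subseteq> points Z \<times> points X"
    using CtrTotRelD(1)[OF assms(1)] CtrTotRelD(1)[OF assms(2)] by blast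
  ultimately show ?thesis by (simp add: CtrTotRel_def)
qed

lemma rel_precI:
  "E \<in> entourages X \<Longrightarrow> F \<in> entourages Y \<Longrightarrow> \<eta> \<subseteq> F O \<eta>' O E \<Longrightarrow> rel_prec X Y \<eta> \<eta>'"
  unfolding rel_prec_def by blast

lemma rel_precE:
  assumes "rel_prec X Y \<eta> \<eta>'"
  obtains E F where "E \<in> entourages X" "F \<in> entourages Y" "\<eta> \<subseteq> F O \<eta>' O E"
  using assms unfolding rel_prec_def by (elim bexE)

lemma rel_prec_refl:
  assumes "coarse_space X" "coarse_space Y" "\<eta> \<in> CtrTotRel X Y"
  shows "rel_prec X Y \<eta> \<eta>"
proof -
  have "\<eta> \<subseteq> Id_on (points Y) O \<eta> O Id_on (points X)"
    using CtrTotRelD(1)[OF assms(3)] by auto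
  with coarse_spaceD(2)[OF assms(1)] coarse_spaceD(2)[OF assms(2)] show ?thesis
    by (rule rel_precI)
qed

lemma rel_prec_trans:
  assumes X: "coarse_space X" and Y: "coarse_space Y"
    and "rel_prec X Y \<eta>\<^sub>1 \<eta>\<^sub>2" "rel_prec X Y \<eta>\<^sub>2 \<eta>\<^sub>3"
  shows "rel_prec X Y \<eta>\<^sub>1 \<eta>\<^sub>3"
proof -
  from assms(3) obtain E F where 1: "E \<in> entourages X" "F \<in> entourages Y" "\<eta>\<^sub>1 \<subseteq> F O \<eta>\<^sub>2 O E"
    by (rule rel_precE)
  from assms(4) obtain E' F' where 2: "E' \<in> entourages X" "F' \<in> entourages Y" "\<eta>\<^sub>2 \<subseteq> F' O \<eta>\<^sub>3 O E'"
    by (rule rel_precE)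
  note 1(3)
  also have "F O \<eta>\<^sub>2 O E \<subseteq> F O (F' O \<eta>\<^sub>3 O E') O E"
    by (intro relcomp_mono order_refl 2(3))
  also have "\<dots> = (F O F') O \<eta>\<^sub>3 O (E' O E)" by (simp add: O_assoc)
  finally show ?thesis
    by (rule rel_precI[OF coarse_spaceD(3)[OF X 2(1) 1(1)] coarse_spaceD(3)[OF Y 1(2) 2(2)]])
qed

text \<open>
  After composing the two bounds, an entourage of the middle space stands between \<open>\<xi>'\<close> and
  \<open>\<eta>'\<close>; it is moved out to the left of \<open>\<xi>'\<close>.
\<close>
lemma rel_prec_relcomp:
  assumes Y: "coarse_space Y" and Z: "coarse_space Z" and \<xi>': "\<xi>' \<in> CtrTotRel Y Z"
    and "rel_prec X Y \<eta> \<eta>'" "rel_prec Y Z \<xi> \<xi>'"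
  shows "rel_prec X Z (\<xi> O \<eta>) (\<xi>' O \<eta>')"
proof -
  from assms(4) obtain E F where 1: "E \<in> entourages X" "F \<in> entourages Y" "\<eta> \<subseteq> F O \<eta>' O E"
    by (rule rel_precE)
  from assms(5) obtain F' G where 2: "F' \<in> entourages Y" "G \<in> entourages Z" "\<xi> \<subseteq> G O \<xi>' O F'"
    by (rule rel_precE)
  have H: "F' O F \<in> entourages Y" by (rule coarse_spaceD(3)[OF Y 2(1) 1(2)])
  have "\<xi> O \<eta> \<subseteq> (G O \<xi>' O F') O (F O \<eta>' O E)"
    using 1(3) 2(3) by (rule relcomp_mono[rotated])
  also have "\<dots> = G O (\<xi>' O (F' O F)) O \<eta>' O E" by (simp add: O_assoc)
  also have "\<dots> \<subseteq> G O (Ad \<xi>' (F' O F) O \<xi>') O \<eta>' O E"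
    by (intro relcomp_mono order_refl total_rel_slide[OF CtrTotRelD(3)[OF \<xi>']]
        coarse_spaceD(1)[OF Y H])
  also have "\<dots> = (G O Ad \<xi>' (F' O F)) O (\<xi>' O \<eta>') O E" by (simp add: O_assoc)
  finally show ?thesis
    by (rule rel_precI[OF 1(1) coarse_spaceD(3)[OF Z 2(2) CtrTotRelD(2)[OF \<xi>' H]]])
qed

definition Coarse_cat :: "('a coarse, ('a \<times> 'a) set) precategory" where
  "Coarse_cat =
     \<lparr> Obj = {X. coarse_space X},
       Hom = CtrTotRel,
       Ident = (\<lambda>X. Id_on (points X)),
       Comp = (\<lambda>X Y Z \<xi> \<eta>. \<xi> O \<eta>) \<rparr>"

lemma is_category_Coarse_cat: "is_category Coarse_cat"
proof -
  have "\<eta> O Id_on (points X) = \<eta>" "Id_on (points Y) O \<eta> = \<eta>"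
    if "\<eta> \<in> CtrTotRel X Y" for \<eta> :: "('a \<times> 'a) set" and X Y :: "'a coarse"
    using CtrTotRelD(1)[OF that] by auto
  then show ?thesis
    by (simp add: is_category_def Coarse_cat_def Id_on_CtrTotRel relcomp_CtrTotRel O_assoc)
qed

lemma equiv_close_eq:
  assumes "coarse_space X" "coarse_space Y"
  shows "equiv (CtrTotRel X Y) (close_eq X Y)"
proof (rule equivI)
  show "close_eq X Y \<subseteq> CtrTotRel X Y \<times> CtrTotRel X Y" by (auto simp: close_eq_def)
  show "refl_on (CtrTotRel X Y) (close_eq X Y)"
    using rel_prec_refl[OF assms] by (auto simp: refl_on_def close_eq_def)
  show "sym (close_eq X Y)" by (auto simp: sym_def close_eq_def)
  show "trans (close_eq X Y)"
    using rel_prec_trans[OF assms] unfolding trans_def close_eq_def by blast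
qed

lemma relcomp_close_eq:
  assumes "coarse_space Y" "coarse_space Z"
    and "(\<eta>, \<eta>') \<in> close_eq X Y" "(\<xi>, \<xi>') \<in> close_eq Y Z"
  shows "(\<xi> O \<eta>, \<xi>' O \<eta>') \<in> close_eq X Z"
proof -
  have mem: "\<eta> \<in> CtrTotRel X Y" "\<eta>' \<in> CtrTotRel X Y" "\<xi> \<in> CtrTotRel Y Z" "\<xi>' \<in> CtrTotRel Y Z"
    and prec: "rel_prec X Y \<eta> \<eta>'" "rel_prec X Y \<eta>' \<eta>" "rel_prec Y Z \<xi> \<xi>'" "rel_prec Y Z \<xi>' \<xi>"
    using assms(3,4) by (simp_all add: close_eq_def)
  from rel_prec_relcomp[OF assms(1,2) mem(4) prec(1,3)]
    rel_prec_relcomp[OF assms(1,2) mem(3) prec(2,4)]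
    relcomp_CtrTotRel[OF mem(1,3)] relcomp_CtrTotRel[OF mem(2,4)]
  show ?thesis by (simp add: close_eq_def)
qed

lemma congruence_on_close_eq: "congruence_on Coarse_cat close_eq"
proof (rule congruence_onI)
  fix X Y :: "'a coarse" assume "X \<in> Obj Coarse_cat" "Y \<in> Obj Coarse_cat"
  then show "equiv (Hom Coarse_cat X Y) (close_eq X Y)"
    by (simp add: Coarse_cat_def equiv_close_eq)
next
  fix X Y Z :: "'a coarse" and \<eta> \<eta>' \<xi> \<xi>'
  assume "Y \<in> Obj Coarse_cat" "Z \<in> Obj Coarse_cat"
    and "(\<eta>, \<eta>') \<in> close_eq X Y" "(\<xi>, \<xi>') \<in> close_eq Y Z"
  then show "(Comp Coarse_cat X Y Z \<xi> \<eta>, Comp Coarse_cat X Y Z \<xi>' \<eta>') \<in> close_eq X Z"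
    by (simp add: Coarse_cat_def relcomp_close_eq[of Y Z \<eta> \<eta>' X \<xi> \<xi>'])
qed

lemma Coarse_close_eq_quotient_cat: "Coarse_close = quotient_cat Coarse_cat close_eq"
  by (simp add: Coarse_close_def quotient_cat_def Coarse_cat_def close_class_def[abs_def])


section \<open>Categories of finite-join pre-ordered sets\<close>

lemma FJ_mapsD:
  assumes "f \<in> FJ_maps P Q"
  shows "f \<in> elts P \<rightarrow>\<^sub>E elts Q"
    and "x \<in> elts P \<Longrightarrow> f x \<in> elts Q"
    and "(x, y) \<in> le P \<Longrightarrow> (f x, f y) \<in> le Q"
    and "S \<subseteq> elts P \<Longrightarrow> finite S \<Longrightarrow> f ` Lub P S \<subseteq> Lub Q (f ` S)"
  using assms by (auto simp: FJ_maps_def order_preserving_def preserves_finite_joins_def)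

lemma Lub_subset_elts: "Lub P S \<subseteq> elts P"
  by (auto simp: Lub_def)

lemma FJ_maps_id:
  assumes "le P \<subseteq> elts P \<times> elts P"
  shows "(\<lambda>x\<in>elts P. x) \<in> FJ_maps P P"
proof -
  have "(\<lambda>x\<in>elts P. x) ` T = T" if "T \<subseteq> elts P" for T
    using that by force
  then show ?thesis
    using assms Lub_subset_elts[of P]
    by (auto simp: FJ_maps_def order_preserving_def preserves_finite_joins_def)
qed

lemma FJ_maps_compose:
  assumes P: "le P \<subseteq> elts P \<times> elts P" and f: "f \<in> FJ_maps P Q" and g: "g \<in> FJ_maps Q R"
  shows "compose (elts P) g f \<in> FJ_maps P R"
proof -
  have img: "compose (elts P) g f ` T = g ` f ` T" if "T \<subseteq> elts P" for T
    using that by (force simp: compose_def)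
  have "preserves_finite_joins P R (compose (elts P) g f)"
    unfolding preserves_finite_joins_def
  proof (intro allI impI)
    fix S assume S: "S \<subseteq> elts P" "finite S"
    have "g ` f ` Lub P S \<subseteq> g ` Lub Q (f ` S)"
      by (intro image_mono FJ_mapsD(4)[OF f S])
    also have "\<dots> \<subseteq> Lub R (g ` f ` S)"
      using S FJ_mapsD(2)[OF f] by (intro FJ_mapsD(4)[OF g]) auto
    finally show "compose (elts P) g f ` Lub P S \<subseteq> Lub R (compose (elts P) g f ` S)"
      by (simp add: img S Lub_subset_elts)
  qed
  moreover have "order_preserving P R (compose (elts P) g f)"
    using P FJ_mapsD(3)[OF f] FJ_mapsD(3)[OF g]
    by (auto simp: order_preserving_def compose_def)
  moreover have "compose (elts P) g f \<in> elts P \<rightarrow>\<^sub>E elts R"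
    using FJ_mapsD(2)[OF f] FJ_mapsD(2)[OF g] by (auto simp: compose_def)
  ultimately show ?thesis by (simp add: FJ_maps_def)
qed

lemma FJ_maps_compose_id:
  assumes "f \<in> FJ_maps P Q"
  shows "compose (elts P) f (\<lambda>x\<in>elts P. x) = f" "compose (elts P) (\<lambda>x\<in>elts Q. x) f = f"
  using FJ_mapsD(1)[OF assms] by (auto simp: compose_def fun_eq_iff PiE_def extensional_def Pi_def)

lemma FJ_maps_compose_assoc:
  assumes "f \<in> FJ_maps P Q"
  shows "compose (elts P) (compose (elts Q) h g) f = compose (elts P) h (compose (elts P) g f)"
  using FJ_mapsD(2)[OF assms] by (auto simp: compose_def fun_eq_iff)

definition FJ_PreOrd :: "('p preord, 'p \<Rightarrow> 'p) precategory" where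
  "FJ_PreOrd =
     \<lparr> Obj = {P. preorder_on (elts P) (le P) \<and> finite_join P},
       Hom = FJ_maps,
       Ident = (\<lambda>P. \<lambda>x\<in>elts P. x),
       Comp = (\<lambda>P Q R g f. compose (elts P) g f) \<rparr>"

lemma preorder_onD:
  assumes "preorder_on (elts P) (le P)"
  shows "le P \<subseteq> elts P \<times> elts P"
    and "x \<in> elts P \<Longrightarrow> (x, x) \<in> le P"
    and "(x, y) \<in> le P \<Longrightarrow> (y, z) \<in> le P \<Longrightarrow> (x, z) \<in> le P"
  using assms by (auto simp: preorder_on_def refl_on_def elim: transE)

lemma is_category_FJ_PreOrd: "is_category FJ_PreOrd"
  by (auto simp: is_category_def FJ_PreOrd_def FJ_maps_compose_id FJ_maps_compose_assoc
      intro!: FJ_maps_id FJ_maps_compose dest: preorder_onD(1))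

lemma equiv_map_eq:
  assumes "preorder_on (elts Q) (le Q)"
  shows "equiv (FJ_maps P Q) (map_eq P Q)"
proof (rule equivI)
  show "map_eq P Q \<subseteq> FJ_maps P Q \<times> FJ_maps P Q" by (auto simp: map_eq_def)
  show "refl_on (FJ_maps P Q) (map_eq P Q)"
    using preorder_onD(2)[OF assms] FJ_mapsD(2) by (force simp: refl_on_def map_eq_def)
  show "sym (map_eq P Q)" by (auto simp: sym_def map_eq_def)
  show "trans (map_eq P Q)"
    using preorder_onD(3)[OF assms] unfolding trans_def map_eq_def by blast
qed

lemma map_eq_compose:
  assumes P: "preorder_on (elts P) (le P)" and R: "preorder_on (elts R) (le R)"
    and f: "(f, f') \<in> map_eq P Q" and g: "(g, g') \<in> map_eq Q R"
  shows "(compose (elts P) g f, compose (elts P) g' f') \<in> map_eq P R"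
proof -
  have F: "f \<in> FJ_maps P Q" "f' \<in> FJ_maps P Q" and G: "g \<in> FJ_maps Q R" "g' \<in> FJ_maps Q R"
    using f g by (auto simp: map_eq_def)
  have "(g (f x), g' (f' x)) \<in> le R \<and> (g' (f' x), g (f x)) \<in> le R" if x: "x \<in> elts P" for x
  proof -
    have fx: "(f x, f' x) \<in> le Q" "(f' x, f x) \<in> le Q" using f x by (auto simp: map_eq_def)
    have gx: "(g (f' x), g' (f' x)) \<in> le R" "(g' (f' x), g (f' x)) \<in> le R"
      using g FJ_mapsD(2)[OF F(2) x] by (auto simp: map_eq_def)
    show ?thesis
      using FJ_mapsD(3)[OF G(1) fx(1)] FJ_mapsD(3)[OF G(1) fx(2)] gx preorder_onD(3)[OF R] by blast
  qed
  then show ?thesis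
    using FJ_maps_compose[OF preorder_onD(1)[OF P] F(1) G(1)]
      FJ_maps_compose[OF preorder_onD(1)[OF P] F(2) G(2)]
    by (simp add: map_eq_def compose_def)
qed

lemma congruence_on_map_eq: "congruence_on FJ_PreOrd map_eq"
proof (rule congruence_onI)
  fix P Q :: "'a preord" assume "P \<in> Obj FJ_PreOrd" "Q \<in> Obj FJ_PreOrd"
  then show "equiv (Hom FJ_PreOrd P Q) (map_eq P Q)"
    by (simp add: FJ_PreOrd_def equiv_map_eq)
next
  fix P Q R :: "'a preord" and f f' g g'
  assume "P \<in> Obj FJ_PreOrd" "R \<in> Obj FJ_PreOrd"
    and "(f, f') \<in> map_eq P Q" "(g, g') \<in> map_eq Q R"
  then show "(Comp FJ_PreOrd P Q R g f, Comp FJ_PreOrd P Q R g' f') \<in> map_eq P R"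
    by (simp add: FJ_PreOrd_def map_eq_compose[of P R f f' Q g g'])
qed

lemma FJ_hPreOrd_eq_quotient_cat: "FJ_hPreOrd = quotient_cat FJ_PreOrd map_eq"
  by (simp add: FJ_hPreOrd_def quotient_cat_def FJ_PreOrd_def map_class_def[abs_def])

lemma open_map_id: "open_map P P (\<lambda>x\<in>elts P. x)"
proof -
  have "(\<lambda>x\<in>elts P. x) ` L = L" if "lower P L" for L
    using that unfolding lower_def by force
  then show ?thesis by (simp add: open_map_def)
qed

lemma open_map_compose:
  assumes "open_map P Q f" "open_map Q R g"
  shows "open_map P R (compose (elts P) g f)"
proof -
  have "compose (elts P) g f ` L = g ` f ` L" if "lower P L" for L
    using that by (force simp: compose_def lower_def)
  then show ?thesis using assms by (simp add: open_map_def)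
qed

lemma is_category_FJ_Par_open: "is_category FJ_Par_open"
  by (auto simp: is_category_def FJ_Par_open_def FJ_maps_compose_id FJ_maps_compose_assoc
      partial_order_on_def
      intro!: FJ_maps_id FJ_maps_compose open_map_id open_map_compose dest: preorder_onD(1))


section \<open>Anti-symmetrization\<close>

lemma equiv_sym_eq:
  assumes "preorder_on (elts P) (le P)"
  shows "equiv (elts P) (sym_eq P)"
proof (rule equivI)
  show "sym_eq P \<subseteq> elts P \<times> elts P" by (auto simp: sym_eq_def)
  show "refl_on (elts P) (sym_eq P)"
    using preorder_onD(2)[OF assms] by (auto simp: refl_on_def sym_eq_def)
  show "sym (sym_eq P)" by (auto simp: sym_def sym_eq_def)
  show "trans (sym_eq P)"
    using preorder_onD(3)[OF assms] unfolding trans_def sym_eq_def by blast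
qed

lemma sym_class_eq_iff:
  assumes "preorder_on (elts P) (le P)" "x \<in> elts P" "y \<in> elts P"
  shows "sym_class P x = sym_class P y \<longleftrightarrow> (x, y) \<in> le P \<and> (y, x) \<in> le P"
  using eq_equiv_class_iff[OF equiv_sym_eq[OF assms(1)] assms(2,3)] assms(2,3)
  by (simp add: sym_class_def sym_eq_def)

lemma elts_antisymmetrization: "elts (antisymmetrization P) = sym_class P ` elts P"
  by (auto simp: antisymmetrization_def quotient_def sym_class_def)

lemma le_antisymmetrization_subset:
  "le (antisymmetrization P) \<subseteq> elts (antisymmetrization P) \<times> elts (antisymmetrization P)"
  by (auto simp: elts_antisymmetrization) (auto simp: antisymmetrization_def)

lemma le_antisymmetrization_iff:
  assumes P: "preorder_on (elts P) (le P)" and xy: "x \<in> elts P" "y \<in> elts P"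
  shows "(sym_class P x, sym_class P y) \<in> le (antisymmetrization P) \<longleftrightarrow> (x, y) \<in> le P"
proof
  assume "(sym_class P x, sym_class P y) \<in> le (antisymmetrization P)"
  then obtain x' y' where "x' \<in> elts P" "y' \<in> elts P" "(x', y') \<in> le P"
    "sym_class P x = sym_class P x'" "sym_class P y = sym_class P y'"
    by (auto simp: antisymmetrization_def)
  then show "(x, y) \<in> le P"
    using preorder_onD(3)[OF P] sym_class_eq_iff[OF P] xy by blast
qed (use xy in \<open>auto simp: antisymmetrization_def\<close>)

lemma le_antisymmetrizationE:
  assumes "(a, b) \<in> le (antisymmetrization P)"
  obtains x y where "x \<in> elts P" "y \<in> elts P" "a = sym_class P x" "b = sym_class P y"
    "(x, y) \<in> le P"
  using assms by (auto simp: antisymmetrization_def)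

lemma partial_order_antisymmetrization:
  assumes P: "preorder_on (elts P) (le P)"
  shows "partial_order_on (elts (antisymmetrization P)) (le (antisymmetrization P))"
  unfolding partial_order_on_def preorder_on_def
proof (intro conjI)
  let ?Q = "antisymmetrization P"
  show sub: "le ?Q \<subseteq> elts ?Q \<times> elts ?Q" by (rule le_antisymmetrization_subset)
  show "refl_on (elts ?Q) (le ?Q)"
    by (auto simp: refl_on_def elts_antisymmetrization le_antisymmetrization_iff[OF P]
        preorder_onD(2)[OF P])
  show "trans (le ?Q)"
  proof (rule transI)
    fix a b c assume "(a, b) \<in> le ?Q" and bc: "(b, c) \<in> le ?Q"
    then obtain x y where xy: "x \<in> elts P" "y \<in> elts P" "a = sym_class P x" "b = sym_class P y"
      "(x, y) \<in> le P"
      by (elim le_antisymmetrizationE)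
    from bc obtain z where z: "z \<in> elts P" "c = sym_class P z"
      by (elim le_antisymmetrizationE)
    have "(y, z) \<in> le P"
      using bc xy z by (simp add: le_antisymmetrization_iff[OF P])
    with xy(5) have "(x, z) \<in> le P" by (rule preorder_onD(3)[OF P])
    then show "(a, c) \<in> le ?Q"
      using xy z by (simp add: le_antisymmetrization_iff[OF P])
  qed
  show "antisym (le ?Q)"
  proof (rule antisymI)
    fix a b assume "(a, b) \<in> le ?Q" and ba: "(b, a) \<in> le ?Q"
    then obtain x y where xy: "x \<in> elts P" "y \<in> elts P" "a = sym_class P x" "b = sym_class P y"
      "(x, y) \<in> le P"
      by (elim le_antisymmetrizationE)
    with ba show "a = b"
      by (simp add: le_antisymmetrization_iff[OF P] sym_class_eq_iff[OF P])
  qed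
qed

text \<open>
  The projection to the anti-symmetrization is surjective and reflects the order, so upper
  bounds, and hence least ones, can be tested on representatives.
\<close>
lemma Lub_antisymmetrization:
  assumes P: "preorder_on (elts P) (le P)" and T: "T \<subseteq> elts P"
  shows "Lub (antisymmetrization P) (sym_class P ` T) = sym_class P ` Lub P T"
proof -
  have "sym_class P u \<in> Lub (antisymmetrization P) (sym_class P ` T) \<longleftrightarrow> u \<in> Lub P T"
    if u: "u \<in> elts P" for u
  proof -
    have "(\<forall>s\<in>T. (sym_class P s, sym_class P v) \<in> le (antisymmetrization P)) \<longleftrightarrow>
          (\<forall>s\<in>T. (s, v) \<in> le P)" if "v \<in> elts P" for v
      using T that by (auto simp: le_antisymmetrization_iff[OF P] subset_iff)
    then show ?thesis
      using u by (simp add: Lub_def elts_antisymmetrization le_antisymmetrization_iff[OF P])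
  qed
  then show ?thesis
    using Lub_subset_elts[of P T] Lub_subset_elts[of "antisymmetrization P" "sym_class P ` T"]
    unfolding elts_antisymmetrization by blast
qed

lemma finite_subset_antisymmetrizationE:
  assumes "S \<subseteq> elts (antisymmetrization P)" "finite S"
  obtains T where "T \<subseteq> elts P" "finite T" "S = sym_class P ` T"
  using finite_subset_image[OF assms(2) assms(1)[unfolded elts_antisymmetrization]] by blast

lemma finite_join_antisymmetrization:
  assumes P: "preorder_on (elts P) (le P)" and "finite_join P"
  shows "finite_join (antisymmetrization P)"
  unfolding finite_join_def
proof (intro allI impI)
  fix S assume "S \<subseteq> elts (antisymmetrization P)" "finite S"
  then obtain T where "T \<subseteq> elts P" "finite T" "S = sym_class P ` T"
    by (rule finite_subset_antisymmetrizationE)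
  then show "Lub (antisymmetrization P) S \<noteq> {}"
    using assms(2) by (simp add: Lub_antisymmetrization[OF P] finite_join_def)
qed

text \<open>
  When \<open>f\<close> is monotone, the sets in the union below are all the same class.
\<close>
definition antisym_map :: "'p preord \<Rightarrow> 'q preord \<Rightarrow> ('p \<Rightarrow> 'q) \<Rightarrow> 'p set \<Rightarrow> 'q set" where
  "antisym_map P Q f = (\<lambda>c\<in>elts (antisymmetrization P). \<Union>x\<in>c. sym_class Q (f x))"

lemma antisym_map_sym_class:
  assumes P: "preorder_on (elts P) (le P)" and Q: "preorder_on (elts Q) (le Q)"
    and f: "f \<in> FJ_maps P Q" and x: "x \<in> elts P"
  shows "antisym_map P Q f (sym_class P x) = sym_class Q (f x)"
proof -
  have "(\<lambda>x. sym_class Q (f x)) respects sym_eq P"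
    by (auto simp: congruent_def sym_eq_def sym_class_eq_iff[OF Q] FJ_mapsD[OF f])
  from UN_equiv_class[OF equiv_sym_eq[OF P] this x] show ?thesis
    using x unfolding antisym_map_def elts_antisymmetrization by (simp add: sym_class_def[of P])
qed

lemma antisym_map_FJ_maps:
  assumes P: "preorder_on (elts P) (le P)" and Q: "preorder_on (elts Q) (le Q)"
    and f: "f \<in> FJ_maps P Q"
  shows "antisym_map P Q f \<in> FJ_maps (antisymmetrization P) (antisymmetrization Q)"
proof -
  note app = antisym_map_sym_class[OF P Q f]
  have img: "antisym_map P Q f ` sym_class P ` T = sym_class Q ` f ` T" if "T \<subseteq> elts P" for T
    using that app by (force simp: image_image)
  have "antisym_map P Q f \<in> elts (antisymmetrization P) \<rightarrow>\<^sub>E elts (antisymmetrization Q)"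
  proof (rule PiE_I)
    fix c assume "c \<in> elts (antisymmetrization P)"
    then show "antisym_map P Q f c \<in> elts (antisymmetrization Q)"
      using app FJ_mapsD(2)[OF f] by (auto simp: elts_antisymmetrization)
  qed (simp add: antisym_map_def)
  moreover have "order_preserving (antisymmetrization P) (antisymmetrization Q) (antisym_map P Q f)"
    unfolding order_preserving_def
  proof (intro allI impI)
    fix a b assume ab: "(a, b) \<in> le (antisymmetrization P)"
    then obtain x y where "x \<in> elts P" "y \<in> elts P" "a = sym_class P x" "b = sym_class P y"
      using le_antisymmetrization_subset[of P] by (auto simp: elts_antisymmetrization)
    with ab show "(antisym_map P Q f a, antisym_map P Q f b) \<in> le (antisymmetrization Q)"
      by (simp add: app le_antisymmetrization_iff[OF P] le_antisymmetrization_iff[OF Q]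
          FJ_mapsD[OF f])
  qed
  moreover have
    "preserves_finite_joins (antisymmetrization P) (antisymmetrization Q) (antisym_map P Q f)"
    unfolding preserves_finite_joins_def
  proof (intro allI impI)
    fix S assume "S \<subseteq> elts (antisymmetrization P)" "finite S"
    then obtain T where T: "T \<subseteq> elts P" "finite T" and S: "S = sym_class P ` T"
      by (rule finite_subset_antisymmetrizationE)
    have fT: "f ` T \<subseteq> elts Q" using T FJ_mapsD(2)[OF f] by blast
    show "antisym_map P Q f ` Lub (antisymmetrization P) S
          \<subseteq> Lub (antisymmetrization Q) (antisym_map P Q f ` S)"
      unfolding S img[OF T(1)] Lub_antisymmetrization[OF P T(1)] Lub_antisymmetrization[OF Q fT]
        img[OF Lub_subset_elts]
      by (intro image_mono FJ_mapsD(4)[OF f T])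
  qed
  ultimately show ?thesis by (simp add: FJ_maps_def)
qed

lemma antisym_map_ext:
  assumes "h \<in> extensional (elts (antisymmetrization P))"
    and "\<And>x. x \<in> elts P \<Longrightarrow> antisym_map P Q f (sym_class P x) = h (sym_class P x)"
  shows "antisym_map P Q f = h"
  by (rule extensionalityI[of _ "elts (antisymmetrization P)"])
     (use assms in \<open>auto simp: antisym_map_def elts_antisymmetrization\<close>)

lemma antisym_map_id:
  assumes P: "preorder_on (elts P) (le P)"
  shows "antisym_map P P (\<lambda>x\<in>elts P. x) = (\<lambda>c\<in>elts (antisymmetrization P). c)"
  by (rule antisym_map_ext)
     (simp_all add: antisym_map_sym_class[OF P P FJ_maps_id[OF preorder_onD(1)[OF P]]]
       elts_antisymmetrization)

lemma antisym_map_compose: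
  assumes P: "preorder_on (elts P) (le P)" and Q: "preorder_on (elts Q) (le Q)"
    and R: "preorder_on (elts R) (le R)"
    and f: "f \<in> FJ_maps P Q" and g: "g \<in> FJ_maps Q R"
  shows "antisym_map P R (compose (elts P) g f) =
         compose (elts (antisymmetrization P)) (antisym_map Q R g) (antisym_map P Q f)"
  by (rule antisym_map_ext)
     (simp_all add: antisym_map_sym_class[OF P Q f] antisym_map_sym_class[OF Q R g]
       antisym_map_sym_class[OF P R FJ_maps_compose[OF preorder_onD(1)[OF P] f g], unfolded compose_def]
       FJ_mapsD[OF f] compose_def elts_antisymmetrization)

text \<open>
  Openness of the induced map is a lifting property of \<open>f\<close>: whatever lies below \<open>f x\<close> is, up to
  equivalence, the value of \<open>f\<close> at something below \<open>x\<close>, and a lower set containing the class of \<open>x\<close>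
  contains the class of that element too.
\<close>
lemma open_map_antisym_map:
  assumes P: "preorder_on (elts P) (le P)" and Q: "preorder_on (elts Q) (le Q)"
    and f: "f \<in> FJ_maps P Q"
    and lift: "\<And>x b. x \<in> elts P \<Longrightarrow> (b, f x) \<in> le Q \<Longrightarrow>
                 \<exists>a. (a, x) \<in> le P \<and> (f a, b) \<in> le Q \<and> (b, f a) \<in> le Q"
  shows "open_map (antisymmetrization P) (antisymmetrization Q) (antisym_map P Q f)"
  unfolding open_map_def
proof (intro allI impI)
  note app = antisym_map_sym_class[OF P Q f]
  fix L assume L: "lower (antisymmetrization P) L"
  show "lower (antisymmetrization Q) (antisym_map P Q f ` L)"
    unfolding lower_def
  proof (intro conjI ballI impI)
    show "antisym_map P Q f ` L \<subseteq> elts (antisymmetrization Q)"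
      using L FJ_mapsD(2)[OF antisym_map_FJ_maps[OF P Q f]] unfolding lower_def by blast
  next
    fix d e
    assume "d \<in> antisym_map P Q f ` L" and "e \<in> elts (antisymmetrization Q)"
      and ed: "(e, d) \<in> le (antisymmetrization Q)"
    then obtain x b where x: "x \<in> elts P" "sym_class P x \<in> L" "d = sym_class Q (f x)"
      and b: "b \<in> elts Q" "e = sym_class Q b"
      using L app unfolding lower_def elts_antisymmetrization by blast
    have "(b, f x) \<in> le Q"
      using ed x b FJ_mapsD(2)[OF f] by (simp add: le_antisymmetrization_iff[OF Q])
    then obtain a where a: "(a, x) \<in> le P" "(f a, b) \<in> le Q" "(b, f a) \<in> le Q"
      using lift x(1) by blast
    have aP: "a \<in> elts P" using a(1) preorder_onD(1)[OF P] by blast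
    have "sym_class P a \<in> L"
      using L x a(1) aP unfolding lower_def
      by (auto simp: elts_antisymmetrization le_antisymmetrization_iff[OF P])
    moreover have "e = antisym_map P Q f (sym_class P a)"
      using a aP b FJ_mapsD(2)[OF f aP] by (simp add: app sym_class_eq_iff[OF Q])
    ultimately show "e \<in> antisym_map P Q f ` L" by blast
  qed
qed


section \<open>Subsets of a coarse space\<close>

lemma rel_app_relcomp: "rel_app (R O S) A = rel_app R (rel_app S A)"
  by (auto simp: rel_app_def)

lemma rel_app_mono: "R \<subseteq> R' \<Longrightarrow> A \<subseteq> A' \<Longrightarrow> rel_app R A \<subseteq> rel_app R' A'"
  by (auto simp: rel_app_def)

lemma rel_app_Id_on: "A \<subseteq> B \<Longrightarrow> rel_app (Id_on B) A = A"
  by (auto simp: rel_app_def)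

lemma rel_app_Union: "rel_app R (\<Union>\<S>) = \<Union>(rel_app R ` \<S>)"
  by (auto simp: rel_app_def)

lemma rel_app_subset: "R \<subseteq> B \<times> C \<Longrightarrow> rel_app R A \<subseteq> B"
  by (auto simp: rel_app_def)

lemma elts_P_obj [simp]: "elts (P_obj X) = Pow (points X)"
  by (simp add: P_obj_def)

lemma le_P_obj_iff:
  "(A, B) \<in> le (P_obj X) \<longleftrightarrow>
     A \<subseteq> points X \<and> B \<subseteq> points X \<and> (\<exists>E\<in>entourages X. A \<subseteq> rel_app E B)"
  by (simp add: P_obj_def)

lemma le_P_objI:
  "A \<subseteq> points X \<Longrightarrow> B \<subseteq> points X \<Longrightarrow> E \<in> entourages X \<Longrightarrow> A \<subseteq> rel_app E B \<Longrightarrow>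
     (A, B) \<in> le (P_obj X)"
  unfolding le_P_obj_iff by blast

lemma le_P_objE:
  assumes "(A, B) \<in> le (P_obj X)"
  obtains E where "A \<subseteq> points X" "B \<subseteq> points X" "E \<in> entourages X" "A \<subseteq> rel_app E B"
  using assms unfolding le_P_obj_iff by (elim conjE bexE)

lemma le_P_obj_subset:
  assumes "coarse_space X" "A \<subseteq> B" "B \<subseteq> points X"
  shows "(A, B) \<in> le (P_obj X)"
proof (rule le_P_objI[OF _ assms(3) coarse_spaceD(2)[OF assms(1)]])
  show "A \<subseteq> points X" using assms(2,3) by (rule subset_trans)
  show "A \<subseteq> rel_app (Id_on (points X)) B" using assms(2) by (simp add: rel_app_Id_on[OF assms(3)])
qed

lemma preorder_P_obj:
  assumes X: "coarse_space X"
  shows "preorder_on (elts (P_obj X)) (le (P_obj X))"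
  unfolding preorder_on_def
proof (intro conjI)
  show "le (P_obj X) \<subseteq> elts (P_obj X) \<times> elts (P_obj X)" by (auto simp: le_P_obj_iff)
  show "refl_on (elts (P_obj X)) (le (P_obj X))"
    using le_P_obj_subset[OF X] by (simp add: refl_on_def)
  show "trans (le (P_obj X))"
  proof (rule transI)
    fix A B C assume AB: "(A, B) \<in> le (P_obj X)" and BC: "(B, C) \<in> le (P_obj X)"
    from AB obtain E where E: "A \<subseteq> points X" "E \<in> entourages X" "A \<subseteq> rel_app E B"
      by (rule le_P_objE)
    from BC obtain F where F: "C \<subseteq> points X" "F \<in> entourages X" "B \<subseteq> rel_app F C"
      by (rule le_P_objE)
    note E(3)
    also have "rel_app E B \<subseteq> rel_app (E O F) C"
      unfolding rel_app_relcomp by (intro rel_app_mono order_refl F(3))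
    finally show "(A, C) \<in> le (P_obj X)"
      by (rule le_P_objI[OF E(1) F(1) coarse_spaceD(3)[OF X E(2) F(2)]])
  qed
qed

text \<open>
  Given finitely many \<open>A \<in> \<S>\<close> with \<open>A \<subseteq> E\<^sub>A(B)\<close>, the entourage \<open>\<Union> E\<^sub>A\<close> bounds all of them at once.
\<close>
lemma Union_le_P_obj:
  assumes X: "coarse_space X" and "finite \<S>" "B \<subseteq> points X"
    and "\<And>A. A \<in> \<S> \<Longrightarrow> (A, B) \<in> le (P_obj X)"
  shows "(\<Union>\<S>, B) \<in> le (P_obj X)"
proof -
  from assms(4) obtain E where E: "\<And>A. A \<in> \<S> \<Longrightarrow> E A \<in> entourages X \<and> A \<subseteq> rel_app (E A) B"
    unfolding le_P_obj_iff by metis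
  have "\<Union>(E ` \<S>) \<in> entourages X"
    using E assms(2) by (intro coarse_spaceD(5)[OF X]) auto
  moreover have "\<Union>\<S> \<subseteq> rel_app (\<Union>(E ` \<S>)) B"
    using E by (fastforce simp: rel_app_def)
  moreover have "\<Union>\<S> \<subseteq> points X" using assms(4) unfolding le_P_obj_iff by blast
  ultimately show ?thesis using assms(3) by (intro le_P_objI)
qed

lemma Lub_P_obj_iff:
  assumes X: "coarse_space X" and S: "finite \<S>" "\<S> \<subseteq> Pow (points X)"
  shows "B \<in> Lub (P_obj X) \<S> \<longleftrightarrow> (\<Union>\<S>, B) \<in> le (P_obj X) \<and> (B, \<Union>\<S>) \<in> le (P_obj X)"
proof -
  have U: "\<Union>\<S> \<subseteq> points X" using S(2) by blast
  note trans = preorder_onD(3)[OF preorder_P_obj[OF X]]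
  have mem: "(A, \<Union>\<S>) \<in> le (P_obj X)" if "A \<in> \<S>" for A
    using that by (intro le_P_obj_subset[OF X _ U]) auto
  have ub: "(\<forall>A\<in>\<S>. (A, C) \<in> le (P_obj X)) \<longleftrightarrow> (\<Union>\<S>, C) \<in> le (P_obj X)"
    if C: "C \<subseteq> points X" for C
  proof
    assume "\<forall>A\<in>\<S>. (A, C) \<in> le (P_obj X)"
    then show "(\<Union>\<S>, C) \<in> le (P_obj X)" by (intro Union_le_P_obj[OF X S(1) C]) simp
  next
    assume U_le: "(\<Union>\<S>, C) \<in> le (P_obj X)"
    show "\<forall>A\<in>\<S>. (A, C) \<in> le (P_obj X)" by (rule ballI, rule trans[OF mem U_le])
  qed
  show ?thesis
  proof
    assume "B \<in> Lub (P_obj X) \<S>"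
    then have BX: "B \<subseteq> points X" and upper: "\<forall>A\<in>\<S>. (A, B) \<in> le (P_obj X)"
      and least: "(\<forall>A\<in>\<S>. (A, \<Union>\<S>) \<in> le (P_obj X)) \<longrightarrow> (B, \<Union>\<S>) \<in> le (P_obj X)"
      using U unfolding Lub_def elts_P_obj by blast+
    have "(B, \<Union>\<S>) \<in> le (P_obj X)" using least mem by (rule mp[OF _ ballI])
    moreover have "(\<Union>\<S>, B) \<in> le (P_obj X)" using upper by (rule iffD1[OF ub[OF BX]])
    ultimately show "(\<Union>\<S>, B) \<in> le (P_obj X) \<and> (B, \<Union>\<S>) \<in> le (P_obj X)" by (intro conjI)
  next
    assume B: "(\<Union>\<S>, B) \<in> le (P_obj X) \<and> (B, \<Union>\<S>) \<in> le (P_obj X)"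
    then have BX: "B \<subseteq> points X" unfolding le_P_obj_iff by (elim conjE)
    show "B \<in> Lub (P_obj X) \<S>"
      unfolding Lub_def elts_P_obj
    proof (intro CollectI conjI ballI impI)
      show "B \<in> Pow (points X)" using BX by (rule PowI)
      show "(A, B) \<in> le (P_obj X)" if "A \<in> \<S>" for A
        using mem[OF that] conjunct1[OF B] by (rule trans)
      show "(B, C) \<in> le (P_obj X)"
        if "C \<in> Pow (points X)" "\<forall>A\<in>\<S>. (A, C) \<in> le (P_obj X)" for C
        using conjunct2[OF B] iffD1[OF ub[OF PowD[OF that(1)]] that(2)] by (rule trans)
    qed
  qed
qed

lemma finite_join_P_obj:
  assumes X: "coarse_space X"
  shows "finite_join (P_obj X)"
  unfolding finite_join_def
proof (intro allI impI)
  fix \<S> assume "\<S> \<subseteq> elts (P_obj X)" "finite \<S>"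
  then have S: "finite \<S>" "\<S> \<subseteq> Pow (points X)" by simp_all
  then have "(\<Union>\<S>, \<Union>\<S>) \<in> le (P_obj X)"
    by (intro le_P_obj_subset[OF X order_refl]) blast
  then have "\<Union>\<S> \<in> Lub (P_obj X) \<S>"
    by (simp add: Lub_P_obj_iff[OF X S])
  then show "Lub (P_obj X) \<S> \<noteq> {}" by blast
qed


section \<open>Images under controlled total relations\<close>

lemma rel_app_controlled_entourage:
  assumes X: "coarse_space X" and \<eta>: "\<eta> \<in> CtrTotRel X Y" and E: "E \<in> entourages X"
  shows "rel_app \<eta> (rel_app E A) \<subseteq> rel_app (Ad \<eta> E) (rel_app \<eta> A)"
  using rel_app_mono[OF total_rel_slide[OF CtrTotRelD(3)[OF \<eta>] coarse_spaceD(1)[OF X E]] order_refl]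
  by (simp add: rel_app_relcomp)

lemma rel_app_le_P_obj:
  assumes X: "coarse_space X" and \<eta>: "\<eta> \<in> CtrTotRel X Y" and "(A, B) \<in> le (P_obj X)"
  shows "(rel_app \<eta> A, rel_app \<eta> B) \<in> le (P_obj Y)"
proof -
  from assms(3) obtain E where E: "E \<in> entourages X" "A \<subseteq> rel_app E B"
    by (rule le_P_objE)
  have "rel_app \<eta> A \<subseteq> rel_app \<eta> (rel_app E B)" by (rule rel_app_mono[OF order_refl E(2)])
  also have "\<dots> \<subseteq> rel_app (Ad \<eta> E) (rel_app \<eta> B)"
    by (rule rel_app_controlled_entourage[OF X \<eta> E(1)])
  finally show ?thesis
    by (rule le_P_objI[OF rel_app_subset[OF CtrTotRelD(1)[OF \<eta>]]
        rel_app_subset[OF CtrTotRelD(1)[OF \<eta>]] CtrTotRelD(2)[OF \<eta> E(1)]])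
qed

lemma rel_prec_le_P_obj:
  assumes X: "coarse_space X" and Y: "coarse_space Y"
    and \<eta>: "\<eta> \<in> CtrTotRel X Y" "\<eta>' \<in> CtrTotRel X Y" and "rel_prec X Y \<eta> \<eta>'"
  shows "(rel_app \<eta> S, rel_app \<eta>' S) \<in> le (P_obj Y)"
proof -
  from assms(5) obtain E F where EF: "E \<in> entourages X" "F \<in> entourages Y" "\<eta> \<subseteq> F O \<eta>' O E"
    by (rule rel_precE)
  have "rel_app \<eta> S \<subseteq> rel_app F (rel_app \<eta>' (rel_app E S))"
    using rel_app_mono[OF EF(3) order_refl] by (simp add: rel_app_relcomp)
  also have "\<dots> \<subseteq> rel_app (F O Ad \<eta>' E) (rel_app \<eta>' S)"
    unfolding rel_app_relcomp
    by (intro rel_app_mono order_refl rel_app_controlled_entourage[OF X \<eta>(2) EF(1)])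
  finally show ?thesis
    by (rule le_P_objI[OF rel_app_subset[OF CtrTotRelD(1)[OF \<eta>(1)]]
        rel_app_subset[OF CtrTotRelD(1)[OF \<eta>(2)]]
        coarse_spaceD(3)[OF Y EF(2) CtrTotRelD(2)[OF \<eta>(2) EF(1)]]])
qed

text \<open>
  The witness \<open>A\<close> consists of those points of \<open>S\<close> that have an image \<open>y'\<close> related by \<open>E\<close> to a
  point of \<open>B\<close>.  A point of \<open>A\<close> may have further images \<open>y\<close>, but \<open>(y, y') \<in> \<eta> \<circ> \<eta>\<^sup>\<dagger>\<close>, and this is
  an entourage; so \<open>\<eta>(A)\<close> is not essentially larger than \<open>B\<close>.
\<close>
lemma rel_app_lift_below:
  assumes X: "coarse_space X" and Y: "coarse_space Y" and \<eta>: "\<eta> \<in> CtrTotRel X Y"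
    and S: "S \<subseteq> points X" and B: "(B, rel_app \<eta> S) \<in> le (P_obj Y)"
  shows "\<exists>A\<subseteq>S. (rel_app \<eta> A, B) \<in> le (P_obj Y) \<and> (B, rel_app \<eta> A) \<in> le (P_obj Y)"
proof -
  from B obtain E where BY: "B \<subseteq> points Y" and E: "E \<in> entourages Y" "B \<subseteq> rel_app E (rel_app \<eta> S)"
    by (rule le_P_objE)
  define A where "A = {s \<in> S. \<exists>b\<in>B. (b, s) \<in> E O \<eta>}"
  let ?D = "Ad \<eta> (Id_on (points X))"
  have AY: "rel_app \<eta> A \<subseteq> points Y" by (rule rel_app_subset[OF CtrTotRelD(1)[OF \<eta>]])
  have D: "?D \<in> entourages Y" by (rule CtrTotRelD(2)[OF \<eta> coarse_spaceD(2)[OF X]])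
  have "B \<subseteq> rel_app E (rel_app \<eta> A)"
  proof
    fix b assume b: "b \<in> B"
    with E(2) obtain y s where "(b, y) \<in> E" "(y, s) \<in> \<eta>" "s \<in> S"
      unfolding rel_app_def by blast
    moreover from this b have "s \<in> A" unfolding A_def by blast
    ultimately show "b \<in> rel_app E (rel_app \<eta> A)" unfolding rel_app_def by blast
  qed
  then have "(B, rel_app \<eta> A) \<in> le (P_obj Y)" by (rule le_P_objI[OF BY AY E(1)])
  moreover have "rel_app \<eta> A \<subseteq> rel_app (?D O converse E) B"
  proof
    fix y assume "y \<in> rel_app \<eta> A"
    then obtain s b y' where s: "s \<in> S" "(y, s) \<in> \<eta>" "b \<in> B" "(b, y') \<in> E" "(y', s) \<in> \<eta>"
      unfolding A_def rel_app_def by blast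
    then have "(s, s) \<in> Id_on (points X)" using S by blast
    with s have "(y, y') \<in> ?D" unfolding Ad_def by blast
    with s show "y \<in> rel_app (?D O converse E) B" unfolding rel_app_def by blast
  qed
  then have "(rel_app \<eta> A, B) \<in> le (P_obj Y)"
    by (rule le_P_objI[OF AY BY coarse_spaceD(3)[OF Y D coarse_spaceD(4)[OF Y E(1)]]])
  moreover have "A \<subseteq> S" by (auto simp: A_def)
  ultimately show ?thesis by blast
qed

lemma P_map_apply [simp]: "S \<subseteq> points X \<Longrightarrow> P_map X \<eta> S = rel_app \<eta> S"
  by (simp add: P_map_def)

text \<open>
  A least upper bound of \<open>\<S>\<close> is a set equivalent to \<open>\<Union>\<S>\<close>; monotonicity sends it to a set equivalent
  to \<open>\<eta>(\<Union>\<S>)\<close>, which is the union of the images.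
\<close>
lemma P_map_FJ_maps:
  assumes X: "coarse_space X" and Y: "coarse_space Y" and \<eta>: "\<eta> \<in> CtrTotRel X Y"
  shows "P_map X \<eta> \<in> FJ_maps (P_obj X) (P_obj Y)"
proof -
  have "P_map X \<eta> \<in> elts (P_obj X) \<rightarrow>\<^sub>E elts (P_obj Y)"
    using rel_app_subset[OF CtrTotRelD(1)[OF \<eta>]] by (auto simp: P_map_def)
  moreover have "order_preserving (P_obj X) (P_obj Y) (P_map X \<eta>)"
    using rel_app_le_P_obj[OF X \<eta>] by (auto simp: order_preserving_def P_map_def le_P_obj_iff)
  moreover have "preserves_finite_joins (P_obj X) (P_obj Y) (P_map X \<eta>)"
    unfolding preserves_finite_joins_def
  proof (intro allI impI)
    fix \<S> assume S: "\<S> \<subseteq> elts (P_obj X)" "finite \<S>"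
    have img: "P_map X \<eta> ` \<S> = rel_app \<eta> ` \<S>" using S(1) by (intro image_cong) auto
    have sub: "rel_app \<eta> ` \<S> \<subseteq> Pow (points Y)"
      using rel_app_subset[OF CtrTotRelD(1)[OF \<eta>]] by auto
    show "P_map X \<eta> ` Lub (P_obj X) \<S> \<subseteq> Lub (P_obj Y) (P_map X \<eta> ` \<S>)"
    proof
      fix C assume "C \<in> P_map X \<eta> ` Lub (P_obj X) \<S>"
      then obtain B where B: "B \<in> Lub (P_obj X) \<S>" "C = P_map X \<eta> B" by blast
      then have "B \<subseteq> points X" using Lub_subset_elts[of "P_obj X" \<S>] by auto
      then have C: "C = rel_app \<eta> B" using B(2) by simp
      have "(\<Union>\<S>, B) \<in> le (P_obj X)" "(B, \<Union>\<S>) \<in> le (P_obj X)"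
        using B(1) S by (simp_all add: Lub_P_obj_iff[OF X])
      then show "C \<in> Lub (P_obj Y) (P_map X \<eta> ` \<S>)"
        unfolding img C Lub_P_obj_iff[OF Y finite_imageI[OF S(2)] sub] rel_app_Union[symmetric]
        by (intro conjI rel_app_le_P_obj[OF X \<eta>])
    qed
  qed
  ultimately show ?thesis by (simp add: FJ_maps_def)
qed

lemma P_map_close:
  assumes X: "coarse_space X" and Y: "coarse_space Y" and c: "(\<eta>, \<eta>') \<in> close_eq X Y"
  shows "(P_map X \<eta>, P_map X \<eta>') \<in> map_eq (P_obj X) (P_obj Y)"
  using c P_map_FJ_maps[OF X Y] rel_prec_le_P_obj[OF X Y] by (auto simp: close_eq_def map_eq_def)

lemma P_map_Id_on: "P_map X (Id_on (points X)) = (\<lambda>S\<in>elts (P_obj X). S)"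
  by (auto simp: P_map_def fun_eq_iff rel_app_Id_on)

lemma P_map_relcomp:
  assumes "\<eta> \<in> CtrTotRel X Y"
  shows "P_map X (\<xi> O \<eta>) = compose (elts (P_obj X)) (P_map Y \<xi>) (P_map X \<eta>)"
  using rel_app_subset[OF CtrTotRelD(1)[OF assms]]
  by (auto simp: P_map_def compose_def fun_eq_iff rel_app_relcomp)


section \<open>The two functors\<close>

lemma is_functor_P_map: "is_functor Coarse_cat FJ_PreOrd P_obj (\<lambda>X Y. P_map X)"
  unfolding is_functor_def
  by (simp add: is_category_Coarse_cat is_category_FJ_PreOrd)
     (simp add: Coarse_cat_def FJ_PreOrd_def preorder_P_obj finite_join_P_obj P_map_FJ_maps
       P_map_Id_on P_map_relcomp del: elts_P_obj)

lemma is_functor_map_class: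
  "is_functor Coarse_cat FJ_hPreOrd P_obj (\<lambda>X Y \<eta>. map_class (P_obj X) (P_obj Y) (P_map X \<eta>))"
  unfolding FJ_hPreOrd_eq_quotient_cat map_class_def
  by (rule is_functor_into_quotient_cat[OF is_functor_P_map congruence_on_map_eq])

lemma P_arr_close_class:
  assumes X: "coarse_space X" and Y: "coarse_space Y" and \<eta>: "\<eta> \<in> CtrTotRel X Y"
  shows "P_arr X Y (close_class X Y \<eta>) = map_class (P_obj X) (P_obj Y) (P_map X \<eta>)"
proof -
  have "(\<lambda>\<eta>. map_class (P_obj X) (P_obj Y) (P_map X \<eta>)) respects close_eq X Y"
    unfolding congruent_def map_class_def
    using P_map_close[OF X Y] equiv_class_eq[OF equiv_map_eq[OF preorder_P_obj[OF Y]]] by blast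
  from UN_equiv_class[OF equiv_close_eq[OF X Y] this \<eta>] show ?thesis
    by (simp add: P_arr_def close_class_def)
qed

lemma is_functor_antisym_map:
  "is_functor Coarse_cat FJ_Par_open Pc_obj
     (\<lambda>X Y \<eta>. antisym_map (P_obj X) (P_obj Y) (P_map X \<eta>))"
proof -
  have "open_map (Pc_obj X) (Pc_obj Y) (antisym_map (P_obj X) (P_obj Y) (P_map X \<eta>))"
    if X: "coarse_space X" and Y: "coarse_space Y" and \<eta>: "\<eta> \<in> CtrTotRel X Y"
    for X Y :: "'a coarse" and \<eta>
    unfolding Pc_obj_def
  proof (rule open_map_antisym_map[OF preorder_P_obj[OF X] preorder_P_obj[OF Y] P_map_FJ_maps[OF that]])
    fix S B assume "S \<in> elts (P_obj X)" "(B, P_map X \<eta> S) \<in> le (P_obj Y)"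
    then have S: "S \<subseteq> points X" and B: "(B, rel_app \<eta> S) \<in> le (P_obj Y)" by auto
    from rel_app_lift_below[OF X Y \<eta> S B] obtain A where A: "A \<subseteq> S"
      "(rel_app \<eta> A, B) \<in> le (P_obj Y)" "(B, rel_app \<eta> A) \<in> le (P_obj Y)" by blast
    moreover have "(A, S) \<in> le (P_obj X)" by (rule le_P_obj_subset[OF X A(1) S])
    ultimately show "\<exists>A. (A, S) \<in> le (P_obj X) \<and> (P_map X \<eta> A, B) \<in> le (P_obj Y) \<and>
        (B, P_map X \<eta> A) \<in> le (P_obj Y)"
      using S by (intro exI[of _ A]) auto
  qed
  then show ?thesis
    unfolding is_functor_def
    by (simp add: is_category_Coarse_cat is_category_FJ_Par_open)
       (simp add: Coarse_cat_def FJ_Par_open_def Pc_obj_def partial_order_antisymmetrization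
         finite_join_antisymmetrization preorder_P_obj finite_join_P_obj antisym_map_FJ_maps
         P_map_FJ_maps P_map_Id_on P_map_relcomp antisym_map_id antisym_map_compose
         del: elts_P_obj)
qed

text \<open>
  The definition takes a union over the representatives of the closeness class and of the class of
  subsets at once; the value depends on neither choice.
\<close>
lemma Pc_arr_sym_class:
  assumes X: "coarse_space X" and Y: "coarse_space Y" and \<eta>: "\<eta> \<in> CtrTotRel X Y"
    and S: "S \<subseteq> points X"
  shows "Pc_arr X Y (close_class X Y \<eta>) (sym_class (P_obj X) S) = sym_class (P_obj Y) (rel_app \<eta> S)"
proof -
  note PX = preorder_P_obj[OF X] and PY = preorder_P_obj[OF Y]
  have "congruent2 (close_eq X Y) (sym_eq (P_obj X)) (\<lambda>\<eta> S. sym_class (P_obj Y) (P_map X \<eta> S))"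
  proof (rule congruent2I)
    show "equiv (CtrTotRel X Y) (close_eq X Y)" by (rule equiv_close_eq[OF X Y])
    show "equiv (elts (P_obj X)) (sym_eq (P_obj X))" by (rule equiv_sym_eq[OF PX])
  next
    fix T \<eta>' \<eta>'' assume T: "T \<in> elts (P_obj X)" and c: "(\<eta>', \<eta>'') \<in> close_eq X Y"
    from P_map_close[OF X Y c] T
    show "sym_class (P_obj Y) (P_map X \<eta>' T) = sym_class (P_obj Y) (P_map X \<eta>'' T)"
      by (subst sym_class_eq_iff[OF PY]) (auto simp: map_eq_def le_P_obj_iff)
  next
    fix \<eta>' T T' assume "\<eta>' \<in> CtrTotRel X Y" and "(T, T') \<in> sym_eq (P_obj X)"
    with FJ_mapsD(2,3)[OF P_map_FJ_maps[OF X Y]]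
    show "sym_class (P_obj Y) (P_map X \<eta>' T) = sym_class (P_obj Y) (P_map X \<eta>' T')"
      by (subst sym_class_eq_iff[OF PY]) (auto simp: sym_eq_def simp del: elts_P_obj P_map_apply)
  qed
  from UN_equiv_class2[OF equiv_close_eq[OF X Y] equiv_sym_eq[OF PX] this \<eta>, of S] S
  show ?thesis
    by (simp add: Pc_arr_def close_class_def Pc_obj_def elts_antisymmetrization
        sym_class_def[of "P_obj X"])
qed

lemma Pc_arr_close_class:
  assumes X: "coarse_space X" and Y: "coarse_space Y" and \<eta>: "\<eta> \<in> CtrTotRel X Y"
  shows "Pc_arr X Y (close_class X Y \<eta>) = antisym_map (P_obj X) (P_obj Y) (P_map X \<eta>)"
proof (rule antisym_map_ext[symmetric])
  show "Pc_arr X Y (close_class X Y \<eta>) \<in> extensional (elts (antisymmetrization (P_obj X)))"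
    by (simp add: Pc_arr_def Pc_obj_def)
next
  fix S assume "S \<in> elts (P_obj X)"
  then show "antisym_map (P_obj X) (P_obj Y) (P_map X \<eta>) (sym_class (P_obj X) S) =
      Pc_arr X Y (close_class X Y \<eta>) (sym_class (P_obj X) S)"
    by (simp add: antisym_map_sym_class[OF preorder_P_obj[OF X] preorder_P_obj[OF Y]
          P_map_FJ_maps[OF assms]] Pc_arr_sym_class[OF assms])
qed

theorem theorem5p3:
  shows
    "is_functor (Coarse_close :: ('a coarse, ('a \<times> 'a) set set) precategory)
       FJ_hPreOrd P_obj P_arr \<and>
     (\<forall>(X :: 'a coarse) (Y :: 'a coarse) \<eta>.
        coarse_space X \<longrightarrow> coarse_space Y \<longrightarrow> \<eta> \<in> CtrTotRel X Y \<longrightarrow>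
          P_arr X Y (close_class X Y \<eta>) = map_class (P_obj X) (P_obj Y) (P_map X \<eta>)) \<and>
     is_functor (Coarse_close :: ('a coarse, ('a \<times> 'a) set set) precategory)
       FJ_Par_open Pc_obj Pc_arr \<and>
     (\<forall>(X :: 'a coarse) (Y :: 'a coarse) \<eta> S.
        coarse_space X \<longrightarrow> coarse_space Y \<longrightarrow> \<eta> \<in> CtrTotRel X Y \<longrightarrow> S \<subseteq> points X \<longrightarrow>
          Pc_arr X Y (close_class X Y \<eta>) (sym_class (P_obj X) S)
            = sym_class (P_obj Y) (rel_app \<eta> S))"
proof (intro conjI allI impI)
  show "is_functor (Coarse_close :: ('a coarse, ('a \<times> 'a) set set) precategory)
          FJ_hPreOrd P_obj P_arr"
    unfolding Coarse_close_eq_quotient_cat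
    by (rule is_functor_from_quotient_cat[OF is_functor_map_class congruence_on_close_eq])
       (simp add: Coarse_cat_def P_arr_close_class[unfolded close_class_def])
  show "is_functor (Coarse_close :: ('a coarse, ('a \<times> 'a) set set) precategory)
          FJ_Par_open Pc_obj Pc_arr"
    unfolding Coarse_close_eq_quotient_cat
    by (rule is_functor_from_quotient_cat[OF is_functor_antisym_map congruence_on_close_eq])
       (simp add: Coarse_cat_def Pc_arr_close_class[unfolded close_class_def])
qed (simp_all add: P_arr_close_class Pc_arr_sym_class)

end
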